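(* Let $m$ be a natural number with prime factorization $m=\prod_{i=1}^w p_i^{b_i}$, where $p_1,\dots,p_w$ are distinct primes and $b_i\geq 1$. Then $$m^2\leq \ell(m)\leq m^{w+1}.$$
   Context: For a natural number $m\geq 1$, $\ell(m)$ denotes the minimal period modulo $m$ of the sequence $n\mapsto\binom{n}{m}$, that is, the least non-zero natural number $\ell$ such that $\binom{n+\ell}{m}\equiv\binom{n}{m}\pmod m$ for all positive integers $n$, with the convention $\binom{n}{m}=0$ if $0\leq n<m$. The paper recalls as known that, for $m=\prod_{i=1}^w p_i^{b_i}$ as in the claim, $\ell(m)=\prod_{i=1}^w p_i^{\lfloor\log_{p_i}m\rfloor+b_i}=m\prod_{i=1}^w p_i^{\lfloor\log_{p_i}m\rfloor}$. *)

theory Defs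
  imports "HOL-Number_Theory.Number_Theory"
begin

text \<open>
  The minimal period modulo m of the sequence of binomial coefficients (n choose m). The library's
  choose on the natural numbers already satisfies the convention that (n choose m) = 0 for n < m.
  The congruence is required for positive n only.
\<close>

definition minimal_period :: "nat \<Rightarrow> nat" where
  "minimal_period m =
     (LEAST l. l \<noteq> 0 \<and> (\<forall>n>0. [(n + l) choose m = n choose m] (mod m)))"

end

theory Submission
  imports Defs
begin

text \<open>
  A number \<open>l\<close> is a period of \<open>n \<mapsto> n choose m\<close> modulo \<open>q\<close> iff
  \<open>q\<close> divides \<open>l choose j\<close> for all \<open>1 \<le> j \<le> m\<close>: sufficiency is Vandermonde's identity,
  necessity follows by taking differences.
  From \<open>j * (l choose j) = l * ((l - 1) choose (j - 1))\<close> we see that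
  \<open>(\<Prod>i=1..w. p i ^ (k i + b i))\<close> is a period, where \<open>k i\<close> is the integer part of
  the logarithm of \<open>m\<close> to base \<open>p i\<close>; this gives the upper bound.
  Conversely, if \<open>p ^ b\<close> divides \<open>m\<close>, then any period \<open>l\<close> is divisible by \<open>p ^ b\<close>
  (take \<open>j = 1\<close>), hence \<open>p\<close> does not divide \<open>(l - 1) choose (p ^ b - 1)\<close>, and
  \<open>j = p ^ b\<close> yields that \<open>p ^ (2 * b)\<close> divides \<open>l\<close>. So \<open>m\<^sup>2\<close> divides every period.
\<close>

lemma cong_choose_add_if_dvd_choose:
  fixes q l m n :: nat
  assumes "\<And>j. 0 < j \<Longrightarrow> j \<le> m \<Longrightarrow> q dvd l choose j"
  shows "[(n + l) choose m = n choose m] (mod q)"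
proof -
  have "(n + l) choose m = (\<Sum>j\<le>m. (l choose j) * (n choose (m - j)))"
    using vandermonde[of l n m] by (simp add: add.commute)
  also have "\<dots> = (\<Sum>j\<in>{0<..m}. (l choose j) * (n choose (m - j))) + (n choose m)"
    by (simp add: atMost_atLeast0 sum.head)
  finally have eq: "(n + l) choose m = \<dots>" .
  have "q dvd (\<Sum>j\<in>{0<..m}. (l choose j) * (n choose (m - j)))"
    using assms by (intro dvd_sum dvd_mult2) auto
  then show ?thesis
    unfolding eq using cong_add_rcancel_0_nat cong_0_iff by blast
qed

lemma dvd_choose_if_cong_choose_add:
  fixes q l m j :: nat
  assumes period: "\<And>n. n > 0 \<Longrightarrow> [(n + l) choose m = n choose m] (mod q)"
    and "0 < j" "j \<le> m"
  shows "q dvd l choose j"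
proof -
  \<comment> \<open>Descending induction from \<open>m\<close>: by Pascal's rule, subtracting the
    congruence for \<open>Suc i\<close> at \<open>n\<close> from the one at \<open>Suc n\<close>
    leaves the congruence for \<open>i\<close>.\<close>
  have lower: "\<forall>n>0. [(n + l) choose i = n choose i] (mod q)" if "i \<le> m" for i
    using that
  proof (induction rule: inc_induct)
    case base
    then show ?case using period by blast
  next
    case (step i)
    show ?case
    proof (intro allI impI)
      fix n :: nat
      assume "n > 0"
      then have "[(Suc n + l) choose Suc i = Suc n choose Suc i] (mod q)"
        and "[(n + l) choose Suc i = n choose Suc i] (mod q)"
        using step.IH by blast+
      then have "[((n + l) choose i) + (n choose Suc i) = (n choose i) + (n choose Suc i)] (mod q)"
        by (metis add_Suc binomial_Suc_Suc cong_add_lcancel_nat cong_sym cong_trans)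
      then show "[(n + l) choose i = n choose i] (mod q)"
        unfolding cong_add_rcancel_nat .
    qed
  qed
  \<comment> \<open>Only positive \<open>n\<close> are available, so evaluation is at 1 instead of
    0; Pascal's rule then gives a sum of two neighbouring coefficients, the first of which the
    induction removes.\<close>
  have "q dvd l choose Suc i" if "Suc i \<le> m" for i
    using that
  proof (induction i)
    case 0
    then have "[l + 1 = 0 + 1] (mod q)"
      using lower[of 1] by (auto dest: spec[of _ 1])
    then show ?case
      unfolding cong_add_rcancel_nat by (simp add: cong_0_iff)
  next
    case (Suc i)
    have "[(1 + l) choose Suc (Suc i) = 1 choose Suc (Suc i)] (mod q)"
      using lower[OF Suc.prems] zero_less_one by blast
    then have "q dvd (l choose Suc i) + (l choose Suc (Suc i))"
      by (simp add: cong_0_iff)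
    then show ?case
      using Suc by (simp add: dvd_add_right_iff)
  qed
  from this[of "j - 1"] assms show ?thesis by simp
qed

text \<open>As \<open>p ^ a\<close> divides \<open>Suc i * (l choose Suc i)\<close> but not
  \<open>Suc i\<close>, the prime \<open>p\<close> divides \<open>l choose Suc i\<close>. By
  Pascal's rule, non-divisibility passes from \<open>i\<close> to \<open>Suc i\<close>.\<close>

lemma prime_not_dvd_choose_pred:
  fixes p l a i :: nat
  assumes "prime p" "p ^ a dvd l" "0 < l" "i < p ^ a"
  shows "\<not> p dvd (l - 1) choose i"
  using assms(4)
proof (induction i)
  case 0
  then show ?case using assms(1) not_prime_1 by fastforce
next
  case (Suc i)
  have "p ^ a dvd Suc i * (l choose Suc i)"
    using times_binomial_minus1_eq[of "Suc i" l] assms(2) by simp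
  moreover have "\<not> p ^ a dvd Suc i"
    using Suc.prems by (auto dest: dvd_imp_le)
  ultimately have "p dvd l choose Suc i"
    using assms(1) by (metis coprime_dvd_mult_left_iff coprime_power_left_iff prime_imp_coprime)
  moreover have "l choose Suc i = ((l - 1) choose i) + ((l - 1) choose Suc i)"
    using assms(3) by (cases l) auto
  ultimately show ?case
    using Suc by (metis Suc_lessD dvd_add_left_iff)
qed

text \<open>The bound on \<open>j\<close> allows it at most \<open>k\<close> factors
  \<open>p\<close>, so at least \<open>b\<close> of them lie in \<open>c\<close>.\<close>

lemma prime_power_dvd_cofactor:
  fixes p j c k b :: nat
  assumes "prime p" "p ^ (k + b) dvd j * c" "0 < j" "j < p ^ Suc k"
  shows "p ^ b dvd c"
\<comment> \<open>By convention \<open>multiplicity p 0\<close> is 0, so counting factors requires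
  \<open>c\<close> to be nonzero.\<close>
proof (cases "c = 0")
  case False
  have "multiplicity p j < Suc k"
    using assms by (intro multiplicity_lessI) (auto dest: dvd_imp_le)
  moreover have "k + b \<le> multiplicity p (j * c)"
    using assms False by (intro multiplicity_geI) auto
  moreover have "multiplicity p (j * c) = multiplicity p j + multiplicity p c"
    using assms False by (intro prime_elem_multiplicity_mult_distrib) auto
  ultimately show ?thesis
    by (intro multiplicity_dvd') linarith
qed simp

lemma prod_prime_powers_dvd:
  fixes p e :: "'a \<Rightarrow> nat" and x :: nat
  assumes "\<And>i. i \<in> A \<Longrightarrow> prime (p i)" "inj_on p A"
    and "\<And>i. i \<in> A \<Longrightarrow> p i ^ e i dvd x"
  shows "(\<Prod>i\<in>A. p i ^ e i) dvd x"
proof -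
  \<comment> \<open>As a congruence to 0, the claim is an instance of combining congruences over
    pairwise coprime moduli.\<close>
  have "[x = 0] (mod (\<Prod>i\<in>A. p i ^ e i))"
  proof (rule coprime_cong_prod_nat)
    show "coprime (p i ^ e i) (p j ^ e j)" if "i \<in> A" "j \<in> A" "i \<noteq> j" for i j
      using that assms(1,2) by (simp add: primes_coprime inj_on_eq_iff)
  qed (use assms(3) in \<open>simp add: cong_0_iff\<close>)
  then show ?thesis by (simp add: cong_0_iff)
qed

lemma prime_power_dvd_period:
  fixes p b l m :: nat
  assumes "prime p" "p ^ b dvd m" "0 < m" "0 < l"
    and "\<And>n. n > 0 \<Longrightarrow> [(n + l) choose m = n choose m] (mod m)"
  shows "p ^ (2 * b) dvd l"
proof -
  have choose: "p ^ b dvd l choose j" if "0 < j" "j \<le> m" for j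
    using dvd_choose_if_cong_choose_add[OF assms(5) that] assms(2) dvd_trans by blast
  have pos: "0 < p ^ b"
    using assms(1) prime_gt_0_nat by simp
  have "p ^ b dvd l"
    using choose[of 1] assms(3) by simp
  then have "\<not> p dvd (l - 1) choose (p ^ b - 1)"
    using assms(1,4) pos by (intro prime_not_dvd_choose_pred) auto
  then have coprime: "coprime (p ^ (2 * b)) ((l - 1) choose (p ^ b - 1))"
    using assms(1) by (simp add: prime_imp_coprime)
  have "p ^ b dvd l choose (p ^ b)"
    using choose pos assms(2,3) by (simp add: dvd_imp_le)
  then have "p ^ b * p ^ b dvd p ^ b * (l choose (p ^ b))"
    by (rule mult_dvd_mono[OF dvd_refl])
  then have "p ^ (2 * b) dvd l * ((l - 1) choose (p ^ b - 1))"
    using times_binomial_minus1_eq[OF pos, of l] by (simp add: mult_2 power_add)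
  then show ?thesis
    using coprime by (simp add: coprime_dvd_mult_left_iff)
qed

theorem corollary2p4:
  fixes m w :: nat and p b :: "nat \<Rightarrow> nat"
  assumes "\<And>i. i \<in> {1..w} \<Longrightarrow> prime (p i)"
    and "inj_on p {1..w}"
    and "\<And>i. i \<in> {1..w} \<Longrightarrow> b i \<ge> 1"
    and "m = (\<Prod>i=1..w. p i ^ b i)"
  shows "m ^ 2 \<le> minimal_period m \<and> minimal_period m \<le> m ^ (w + 1)"
proof -
  let ?period = "\<lambda>l. l \<noteq> 0 \<and> (\<forall>n>0. [(n + l) choose m = n choose m] (mod m))"
  have m_pos: "0 < m"
    unfolding assms(4) using assms(1) prime_gt_0_nat by (intro prod_pos) simp
  have "\<exists>k. p i ^ k \<le> m \<and> m < p i ^ (k + 1)" if "i \<in> {1..w}" for i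
    using that assms(1) m_pos by (intro ex_power_ivl1) (auto dest: prime_ge_2_nat)
  then obtain k where k: "\<And>i. i \<in> {1..w} \<Longrightarrow> p i ^ k i \<le> m \<and> m < p i ^ Suc (k i)"
    by (metis Suc_eq_plus1)
  define L where "L = (\<Prod>i=1..w. p i ^ (k i + b i))"
  have L_pos: "0 < L"
    unfolding L_def using assms(1) prime_gt_0_nat by (intro prod_pos) simp
  have "m dvd L choose j" if j: "0 < j" "j \<le> m" for j
    unfolding assms(4)
  proof (rule prod_prime_powers_dvd[OF assms(1,2)])
    fix i
    assume i: "i \<in> {1..w}"
    have "p i ^ (k i + b i) dvd L"
      unfolding L_def using i by (intro dvd_prodI) auto
    then have "p i ^ (k i + b i) dvd j * (L choose j)"
      using times_binomial_minus1_eq[OF j(1), of L] by simp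
    then show "p i ^ b i dvd L choose j"
      using prime_power_dvd_cofactor[OF assms(1)[OF i] _ j(1)] k[OF i] j(2) by (metis le_less_trans)
  qed
  then have period_L: "?period L"
    using L_pos cong_choose_add_if_dvd_choose[of m m L] by blast
  \<comment> \<open>Each of the \<open>w\<close> factors \<open>p i ^ k i\<close> is at most
    \<open>m\<close>; the remaining part of \<open>L\<close> is \<open>m\<close> itself.\<close>
  have "(\<Prod>i=1..w. p i ^ k i) \<le> (\<Prod>i=1..w. m)"
    using k by (intro prod_mono) auto
  then have "(\<Prod>i=1..w. p i ^ k i) * m \<le> m ^ w * m"
    by simp
  moreover have "L = (\<Prod>i=1..w. p i ^ k i) * m"
    unfolding L_def assms(4) by (simp add: power_add prod.distrib)
  ultimately have "L \<le> m ^ w * m"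
    by simp
  moreover have "minimal_period m \<le> L"
    unfolding minimal_period_def by (rule Least_le[of ?period, OF period_L])
  ultimately have upper: "minimal_period m \<le> m ^ (w + 1)"
    by (simp add: mult.commute)
  \<comment> \<open>\<open>L\<close> witnesses that a period exists, so the \<open>LEAST\<close> is
    attained.\<close>
  have period_min: "?period (minimal_period m)"
    unfolding minimal_period_def using LeastI[of ?period, OF period_L] .
  have "(\<Prod>i=1..w. p i ^ (2 * b i)) dvd minimal_period m"
  proof (rule prod_prime_powers_dvd[OF assms(1,2)])
    fix i
    assume i: "i \<in> {1..w}"
    then have "p i ^ b i dvd m"
      unfolding assms(4) by (intro dvd_prodI) auto
    then show "p i ^ (2 * b i) dvd minimal_period m"
      using prime_power_dvd_period[OF assms(1)[OF i] _ m_pos] period_min by blast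
  qed
  moreover have "(\<Prod>i=1..w. p i ^ (2 * b i)) = m ^ 2"
    unfolding assms(4) prod_power_distrib by (simp add: power_even_eq)
  ultimately have "m ^ 2 dvd minimal_period m"
    by simp
  then show ?thesis
    using upper period_min by (auto dest: dvd_imp_le)
qed

end
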